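(* Let $0 < c \le d$ be real numbers and suppose that $P \subseteq \mathbb{R}^2$ is a nonempty finite subset in which the distances between all consecutive pairs of rows and all consecutive pairs of columns are in $[c, d]$. Let $q > 1$ and let $P' = \{(qx, qy) : (x,y) \in P\}$ be the dilation of $P$ by a factor of $q$. Then for all real $n > 0$, $$\operatorname{opx}(n, P') \le \left(\left\lceil \tfrac{qd}{c} \right\rceil + 1\right)^2 \operatorname{opx}\left( \left\lceil \frac{\lceil \frac{n}{c} \rceil}{\lceil \frac{qd}{c} \rceil + 1} \right\rceil c,\ P \right).$$
   Context: Containment for subsets of the plane: for $P, S \subseteq \mathbb{R}^2$, let $X_P, Y_P$ be the sets of $x$-coordinates and $y$-coordinates of points of $P$, and $X_S, Y_S$ likewise for $S$. $S$ contains $P$ if there exist functions $f_X: X_P \to X_S$ and $f_Y: Y_P \to Y_S$ such that (1) $\frac{f_X(x_0)-f_X(x_1)}{x_0-x_1} \ge 1$ for all $x_0 > x_1$ in $X_P$; (2) $\frac{f_Y(y_0)-f_Y(y_1)}{y_0-y_1} \ge 1$ for all $y_0 > y_1$ in $Y_P$; (3) $(f_X(x), f_Y(y)) \in S$ for all $(x,y) \in P$. Otherwise $S$ is $P$-free. For real $n > 0$, $\operatorname{opx}(n,P)$ is the supremum of the Lebesgue measure $\mu_2(S)$ over all open (in $\mathbb{R}^2$) $P$-free subsets $S \subseteq [0,n]^2$. The rows of $P$ are its maximal subsets with the same $y$-coordinate; the columns of $P$ are its maximal subsets with the same $x$-coordinate. The distance between two rows (columns) is the absolute difference of their $y$-coordinates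 ($x$-coordinates). *)

theory Defs
  imports "HOL-Analysis.Analysis"
begin

definition contains :: "(real \<times> real) set \<Rightarrow> (real \<times> real) set \<Rightarrow> bool" where
  "contains S P \<longleftrightarrow>
    (\<exists>fX\<in>fst ` P \<rightarrow> fst ` S. \<exists>fY\<in>snd ` P \<rightarrow> snd ` S.
      (\<forall>x0\<in>fst ` P. \<forall>x1\<in>fst ` P. x0 > x1 \<longrightarrow> (fX x0 - fX x1) / (x0 - x1) \<ge> 1) \<and>
      (\<forall>y0\<in>snd ` P. \<forall>y1\<in>snd ` P. y0 > y1 \<longrightarrow> (fY y0 - fY y1) / (y0 - y1) \<ge> 1) \<and>
      (\<forall>(x, y)\<in>P. (fX x, fY y) \<in> S))"

abbreviation free_of :: "(real \<times> real) set \<Rightarrow> (real \<times> real) set \<Rightarrow> bool" where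
  "free_of S P \<equiv> \<not> contains S P"

(* For nonempty P the supremum is a genuine one: the empty set is P-free, and all the
   measures are at most n^2.  For empty P no set is P-free and the value is unspecified. *)
definition opx :: "real \<Rightarrow> (real \<times> real) set \<Rightarrow> real" where
  "opx n P = Sup {measure lebesgue S | S. open S \<and> S \<subseteq> {0..n} \<times> {0..n} \<and> free_of S P}"

(* The maximal nonempty subsets of P on which the coordinate function u is constant:
   rows for u = snd, columns for u = fst. *)
definition lines :: "(real \<times> real \<Rightarrow> real) \<Rightarrow> (real \<times> real) set \<Rightarrow> (real \<times> real) set set" where
  "lines u P = {L. L \<noteq> {} \<and> L \<subseteq> P \<and> (\<exists>t. \<forall>p\<in>L. u p = t) \<and>
     (\<forall>M. L \<subseteq> M \<and> M \<subseteq> P \<and> (\<exists>t. \<forall>p\<in>M. u p = t) \<longrightarrow> M = L)}"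

(* The common value of u on a line. *)
definition line_coord :: "(real \<times> real \<Rightarrow> real) \<Rightarrow> (real \<times> real) set \<Rightarrow> real" where
  "line_coord u L = the_elem (u ` L)"

definition line_dist :: "(real \<times> real \<Rightarrow> real) \<Rightarrow> (real \<times> real) set \<Rightarrow> (real \<times> real) set \<Rightarrow> real" where
  "line_dist u L M = \<bar>line_coord u L - line_coord u M\<bar>"

abbreviation "row_dist \<equiv> line_dist snd"
abbreviation "column_dist \<equiv> line_dist fst"

definition consecutive_lines ::
    "(real \<times> real \<Rightarrow> real) \<Rightarrow> (real \<times> real) set \<Rightarrow> (real \<times> real) set \<Rightarrow> (real \<times> real) set \<Rightarrow> bool" where
  "consecutive_lines u P L M \<longleftrightarrow> L \<in> lines u P \<and> M \<in> lines u P \<and> line_coord u L < line_coord u M \<and>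
     \<not> (\<exists>K\<in>lines u P. line_coord u L < line_coord u K \<and> line_coord u K < line_coord u M)"

abbreviation "consecutive_rows \<equiv> consecutive_lines snd"
abbreviation "consecutive_columns \<equiv> consecutive_lines fst"

definition dilation :: "real \<Rightarrow> (real \<times> real) set \<Rightarrow> (real \<times> real) set" where
  "dilation q P = {(q * x, q * y) | x y. (x, y) \<in> P}"

end

theory Submission
  imports Defs
begin

text \<open>
  Cut the plane into open cells of side \<open>c\<close> and put \<open>K = \<lceil>q d / c\<rceil> + 1\<close>. Keeping only the
  cells whose two indices lie in prescribed residue classes modulo \<open>K\<close>, and pushing the kept
  cells together, turns an open set \<open>S\<close> into one of \<open>K\<^sup>2\<close> sets whose measures add up to that of \<open>S\<close>. If such
  a set contained \<open>P\<close>, then, consecutive columns being at distance at least \<open>c\<close>, their images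
  would lie in different strips; pulling the strips apart again separates them by a further
  \<open>(K - 1) c \<ge> q d\<close>, so that \<open>S\<close> would contain the dilation of \<open>P\<close>.
\<close>

section \<open>Rows and columns as fibres of a coordinate function\<close>

lemma fibre_in_lines:
  assumes "x \<in> u ` P"
  shows "{p \<in> P. u p = x} \<in> lines u P" and "line_coord u {p \<in> P. u p = x} = x"
proof -
  obtain p0 where p0: "p0 \<in> P" "u p0 = x" using assms by auto
  show "{p \<in> P. u p = x} \<in> lines u P"
    unfolding lines_def
  proof (intro CollectI conjI allI impI)
    fix M assume M: "{p \<in> P. u p = x} \<subseteq> M \<and> M \<subseteq> P \<and> (\<exists>t. \<forall>p\<in>M. u p = t)"
    then obtain t where "\<forall>p\<in>M. u p = t" by blast
    moreover have "p0 \<in> M" using M p0 by blast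
    ultimately show "M = {p \<in> P. u p = x}" using M p0 by fastforce
  next
    show "{p \<in> P. u p = x} \<noteq> {}" using p0 by blast
  qed auto
  have "u ` {p \<in> P. u p = x} = {x}" using p0 by auto
  then show "line_coord u {p \<in> P. u p = x} = x" by (simp add: line_coord_def)
qed

lemma line_coord_in_image:
  assumes "L \<in> lines u P"
  shows "line_coord u L \<in> u ` P"
proof -
  obtain p t where p: "p \<in> L" "L \<subseteq> P" "\<forall>p\<in>L. u p = t"
    using assms unfolding lines_def by blast
  then have "u ` L = {t}" by auto
  then show ?thesis using p by (force simp: line_coord_def)
qed

lemma consecutive_coords_dist:
  assumes "\<And>L M. consecutive_lines u P L M \<Longrightarrow> line_dist u L M \<in> {c..d}"
    and "x \<in> u ` P" "y \<in> u ` P" "x < y" "u ` P \<inter> {x<..<y} = {}"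
  shows "y - x \<in> {c..d}"
proof -
  let ?L = "\<lambda>x. {p \<in> P. u p = x}"
  note f = fibre_in_lines[OF assms(2)] fibre_in_lines[OF assms(3)]
  have "consecutive_lines u P (?L x) (?L y)"
    unfolding consecutive_lines_def f(2) f(4)
  proof (intro conjI f(1,3) \<open>x < y\<close> notI)
    assume "\<exists>K\<in>lines u P. x < line_coord u K \<and> line_coord u K < y"
    then obtain K where "K \<in> lines u P" "line_coord u K \<in> {x<..<y}" by auto
    then show False using line_coord_in_image assms(5) by blast
  qed
  from assms(1)[OF this] show ?thesis
    using assms(4) unfolding line_dist_def f(2) f(4) by simp
qed

section \<open>Expansion estimates from consecutive points\<close>

text \<open>Induction on the number of points of \<open>A\<close> strictly between \<open>x\<close>
  and \<open>y\<close>: any such point splits the interval into two with fewer. Growth can thus be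
  tested on neighbours, the only pairs with an upper bound \<open>d\<close> on their
  distance.\<close>

lemma mono_on_finite_of_consecutive:
  fixes h :: "real \<Rightarrow> real"
  assumes "finite A"
    and step: "\<And>x y. \<lbrakk>x \<in> A; y \<in> A; x < y; A \<inter> {x<..<y} = {}\<rbrakk> \<Longrightarrow> h x \<le> h y"
  shows "\<lbrakk>x \<in> A; y \<in> A; x < y\<rbrakk> \<Longrightarrow> h x \<le> h y"
proof (induction "card (A \<inter> {x<..<y})" arbitrary: x y rule: less_induct)
  case less
  show ?case
  proof (cases "A \<inter> {x<..<y} = {}")
    case True
    then show ?thesis using step less.prems by blast
  next
    case False
    then obtain z where z: "z \<in> A" "x < z" "z < y" by auto
    have "A \<inter> {x<..<z} \<subset> A \<inter> {x<..<y}" "A \<inter> {z<..<y} \<subset> A \<inter> {x<..<y}"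
      using z by auto
    then have "card (A \<inter> {x<..<z}) < card (A \<inter> {x<..<y})"
      "card (A \<inter> {z<..<y}) < card (A \<inter> {x<..<y})"
      using \<open>finite A\<close> by (auto intro!: psubset_card_mono)
    then have "h x \<le> h z" "h z \<le> h y" using less z by auto
    then show ?thesis by simp
  qed
qed

text \<open>The strip with index \<open>m\<close> is moved to the strip with index \<open>i + (k + 1) m\<close>.\<close>

definition spread :: "real \<Rightarrow> nat \<Rightarrow> nat \<Rightarrow> real \<Rightarrow> real" where
  "spread c k i x = x + (real i + real k * of_int \<lfloor>x / c\<rfloor>) * c"

text \<open>Between neighbours \<open>f\<close> advances by at least \<open>c\<close>, so the floor
  in \<open>spread\<close> rises by at least 1. Its term then grows by at least
  \<open>k * c\<close>, hence by \<open>q * d\<close>, which dominates \<open>q * (y - x)\<close>;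
  the remaining growth \<open>f y - f x\<close> is positive.\<close>

lemma spread_expands:
  assumes "0 < c" and "finite A" and kc: "q * d \<le> real k * c" and "0 < q"
    and gap: "\<And>x y. \<lbrakk>x \<in> A; y \<in> A; x < y; A \<inter> {x<..<y} = {}\<rbrakk> \<Longrightarrow> y - x \<in> {c..d}"
    and f: "\<And>x y. \<lbrakk>x \<in> A; y \<in> A; x < y\<rbrakk> \<Longrightarrow> y - x \<le> f y - f x"
    and xy: "x \<in> A" "y \<in> A" "x < y"
  shows "q * (y - x) \<le> spread c k i (f y) - spread c k i (f x)"
proof -
  \<comment> \<open>Subtracting \<open>q * x\<close> turns the claim into monotonicity, which is
    inherited from neighbours.\<close>
  let ?h = "\<lambda>x. spread c k i (f x) - q * x"
  have "?h x \<le> ?h y"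
  proof (rule mono_on_finite_of_consecutive[OF \<open>finite A\<close> _ xy])
    fix x y assume *: "x \<in> A" "y \<in> A" "x < y" "A \<inter> {x<..<y} = {}"
    have g: "c \<le> y - x" "y - x \<le> d" "y - x \<le> f y - f x"
      using gap[OF *] f[OF *(1-3)] by auto
    have "f x / c + 1 \<le> f y / c"
      using g \<open>0 < c\<close> by (simp add: pos_le_divide_eq distrib_right)
    then have "\<lfloor>f x / c\<rfloor> + 1 \<le> \<lfloor>f y / c\<rfloor>" by linarith
    then have "real_of_int \<lfloor>f x / c\<rfloor> + 1 \<le> real_of_int \<lfloor>f y / c\<rfloor>" by linarith
    then have "(real k * c) * (real_of_int \<lfloor>f x / c\<rfloor> + 1) \<le> (real k * c) * real_of_int \<lfloor>f y / c\<rfloor>"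
      using \<open>0 < c\<close> by (intro mult_left_mono) auto
    moreover have "q * (y - x) \<le> q * d"
      using g \<open>0 < q\<close> by simp
    ultimately show "?h x \<le> ?h y"
      using kc g *(3) unfolding spread_def by (simp add: algebra_simps)
  qed
  then show ?thesis by (simp add: algebra_simps)
qed

section \<open>Strips and cells\<close>

text \<open>The end points are left out so that cells, and later the sets assembled from them, are
  open as \<open>opx\<close> demands; the grid lines lost have measure 0.\<close>

definition strip :: "real \<Rightarrow> nat \<Rightarrow> real set" where
  "strip c a = {real a * c <..< (real a + 1) * c}"

lemma floor_strip:
  assumes "0 < c" "x \<in> strip c a"
  shows "\<lfloor>x / c\<rfloor> = int a"
  using assms by (simp add: strip_def floor_eq_iff field_simps)

lemma disjoint_strips:
  assumes "0 < c" "a \<noteq> b"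
  shows "strip c a \<inter> strip c b = {}"
proof (rule ccontr)
  assume "strip c a \<inter> strip c b \<noteq> {}"
  then obtain x where "x \<in> strip c a" "x \<in> strip c b" by blast
  then have "int a = int b" using floor_strip[OF \<open>0 < c\<close>] by metis
  then show False using \<open>a \<noteq> b\<close> by simp
qed

lemma in_strip_or_grid:
  assumes "0 < c" "0 \<le> x" "x \<le> real L * c"
  shows "(\<exists>a<L. x \<in> strip c a) \<or> (\<exists>a\<le>L. x = real a * c)"
proof -
  define a where "a = nat \<lfloor>x / c\<rfloor>"
  have "0 \<le> x / c" using assms by simp
  then have a: "real a \<le> x / c" "x / c < real a + 1"
    unfolding a_def by linarith+
  have xc: "x / c \<le> real L" using assms by (simp add: pos_divide_le_eq)
  have "real a \<le> real L" using a(1) xc by linarith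
  then have "a \<le> L" by simp
  show ?thesis
  proof (cases "x = real a * c")
    case True
    then show ?thesis using \<open>a \<le> L\<close> by blast
  next
    case False
    then have x: "x \<in> strip c a"
      using a \<open>0 < c\<close> by (simp add: strip_def field_simps)
    \<comment> \<open>The strict left end of the strip excludes \<open>a = L\<close>, which occurs
      only for the grid point \<open>x = real L * c\<close>.\<close>
    have "real a * c < real L * c" using x assms(3) by (simp add: strip_def)
    then have "a < L" using \<open>0 < c\<close> by simp
    then show ?thesis using x by blast
  qed
qed

definition cell :: "real \<Rightarrow> nat \<Rightarrow> nat \<Rightarrow> (real \<times> real) set" where
  "cell c a b = strip c a \<times> strip c b"

lemma open_cell: "open (cell c a b)"
  by (simp add: cell_def strip_def open_Times)

section \<open>Compression and its measure\<close>

text \<open>The shift takes strip \<open>i + (k + 1) * a\<close> to strip \<open>a\<close>, since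
  the indices differ by \<open>i + k * a\<close>; likewise for \<open>j\<close> and
  \<open>b\<close>. As a translation it preserves openness and measure.\<close>

definition compressed :: "real \<Rightarrow> nat \<Rightarrow> nat \<Rightarrow> nat \<Rightarrow> (real \<times> real) set \<Rightarrow> nat \<Rightarrow> nat \<Rightarrow> (real \<times> real) set"
  where
  "compressed c k i j S a b =
     (+) (- (real i + real k * real a) * c, - (real j + real k * real b) * c) `
       (S \<inter> cell c (i + (k + 1) * a) (j + (k + 1) * b))"

definition compression :: "real \<Rightarrow> nat \<Rightarrow> nat \<Rightarrow> (real \<times> real) set \<Rightarrow> nat \<Rightarrow> nat \<Rightarrow> (real \<times> real) set"
  where
  "compression c k M S i j = (\<Union>(a, b)\<in>{..<M} \<times> {..<M}. compressed c k i j S a b)"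

lemma compressed_subset_cell: "compressed c k i j S a b \<subseteq> cell c a b"
  by (auto simp: compressed_def cell_def strip_def algebra_simps)

lemma open_compressed: "open S \<Longrightarrow> open (compressed c k i j S a b)"
  unfolding compressed_def by (intro open_translation open_Int open_cell)

lemma open_compression: "open S \<Longrightarrow> open (compression c k M S i j)"
  unfolding compression_def by (auto intro: open_compressed)

lemma measure_compressed:
  "measure lebesgue (compressed c k i j S a b) =
     measure lebesgue (S \<inter> cell c (i + (k + 1) * a) (j + (k + 1) * b))"
  unfolding compressed_def by (rule measure_translation)

lemma compression_subset:
  assumes "0 < c"
  shows "compression c k M S i j \<subseteq> {0..real M * c} \<times> {0..real M * c}"
proof -
  have "strip c a \<subseteq> {0..real M * c}" if "a < M" for a
  proof -
    have "0 \<le> real a * c" "(real a + 1) * c \<le> real M * c"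
      using that assms by (auto intro!: mult_right_mono)
    then show ?thesis by (auto simp: strip_def)
  qed
  then have "cell c a b \<subseteq> {0..real M * c} \<times> {0..real M * c}" if "a < M" "b < M" for a b
    unfolding cell_def using that by (intro Sigma_mono) auto
  then show ?thesis
    unfolding compression_def using subset_trans[OF compressed_subset_cell]
    by (intro UN_least) (simp add: case_prod_unfold mem_Times_iff)
qed

text \<open>On strip \<open>a\<close> the floor in \<open>spread\<close> is the constant
  \<open>a\<close>, so \<open>spread\<close> is there exactly the inverse of the translation in
  \<open>compressed\<close>.\<close>

lemma spread_compression:
  assumes "0 < c" and "(x, y) \<in> compression c k M S i j"
  shows "(spread c k i x, spread c k j y) \<in> S"
proof -
  obtain a b where ab: "(x, y) \<in> compressed c k i j S a b"
    using assms(2) by (auto simp: compression_def)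
  have "x \<in> strip c a" "y \<in> strip c b"
    using subsetD[OF compressed_subset_cell ab] by (simp_all add: cell_def)
  note fl = this[THEN floor_strip[OF \<open>0 < c\<close>]]
  obtain p where "p \<in> S"
    and p: "(x, y) = (- (real i + real k * real a) * c, - (real j + real k * real b) * c) + p"
    using ab unfolding compressed_def by (rule imageE) (rule that, auto)
  have "(spread c k i x, spread c k j y) = p"
    unfolding spread_def fl using p by (cases p) (simp add: algebra_simps)
  then show ?thesis using \<open>p \<in> S\<close> by simp
qed

text \<open>The translated pieces lie in distinct cells, hence are disjoint, and each keeps its
  measure.\<close>

lemma measure_compression:
  assumes "0 < c" "open S" "bounded S"
  shows "measure lebesgue (compression c k M S i j) =
    (\<Sum>a<M. \<Sum>b<M. measure lebesgue (S \<inter> cell c (i + (k + 1) * a) (j + (k + 1) * b)))"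
proof -
  let ?C = "\<lambda>p. compressed c k i j S (fst p) (snd p)"
  \<comment> \<open>Boundedness matters for additivity: \<open>measure\<close> takes the value 0 on
    sets of infinite measure.\<close>
  have lm: "?C p \<in> lmeasurable" for p
    using assms open_compressed[OF assms(2)]
    by (intro lmeasurable_open)
      (auto simp: compressed_def intro!: bounded_translation bounded_Int)
  have dis: "disjoint_family_on ?C ({..<M} \<times> {..<M})"
    unfolding disjoint_family_on_def
  proof (intro ballI impI)
    fix p r :: "nat \<times> nat" assume "p \<noteq> r"
    then have "cell c (fst p) (snd p) \<inter> cell c (fst r) (snd r) = {}"
      using disjoint_strips[OF \<open>0 < c\<close>] unfolding cell_def Times_Int_Times
      by (metis Sigma_empty1 Sigma_empty2 prod_eqI)
    then show "?C p \<inter> ?C r = {}"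
      using compressed_subset_cell by blast
  qed
  have "measure lebesgue (compression c k M S i j) = measure lebesgue (\<Union> (?C ` ({..<M} \<times> {..<M})))"
    by (simp add: compression_def case_prod_unfold)
  also have "\<dots> = (\<Sum>p\<in>{..<M} \<times> {..<M}. measure lebesgue (?C p))"
    using lm dis fmeasurableD2[OF lm] by (intro measure_finite_Union) auto
  also have "\<dots> = (\<Sum>a<M. \<Sum>b<M. measure lebesgue (compressed c k i j S a b))"
    by (simp add: sum.cartesian_product case_prod_unfold)
  finally show ?thesis by (simp add: measure_compressed)
qed

section \<open>Decomposition of the measure over cells\<close>

lemma negligible_grid:
  "negligible {p :: real \<times> real. \<exists>a\<le>L. fst p = real a * c \<or> snd p = real a * c}"
proof -
  have "negligible {p :: real \<times> real. p \<bullet> (1, 0) = real a * c}"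
    "negligible {p :: real \<times> real. p \<bullet> (0, 1) = real a * c}" for a
    by (intro negligible_standard_hyperplane; simp add: Basis_prod_def)+
  then have "negligible (\<Union>a\<le>L. {p :: real \<times> real. p \<bullet> (1, 0) = real a * c}
      \<union> {p. p \<bullet> (0, 1) = real a * c})"
    by (intro negligible_Union) auto
  then show ?thesis
    by (rule negligible_subset) (auto simp: inner_prod_def)
qed

text \<open>Off the null set \<open>G\<close> of grid lines the cells cover \<open>S\<close>, so
  subadditivity gives the bound.\<close>

lemma measure_le_sum_cells:
  assumes "0 < c" "open S" "S \<subseteq> {0..real L * c} \<times> {0..real L * c}"
  shows "measure lebesgue S \<le> (\<Sum>a<L. \<Sum>b<L. measure lebesgue (S \<inter> cell c a b))"
proof -
  let ?C = "\<lambda>p. S \<inter> cell c (fst p) (snd p)"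
  define G where "G = {p :: real \<times> real. \<exists>a\<le>L. fst p = real a * c \<or> snd p = real a * c}"
  define U where "U = \<Union> (?C ` ({..<L} \<times> {..<L}))"
  have "bounded S"
    by (rule bounded_subset[OF _ assms(3)]) (intro bounded_Times bounded_closed_interval)
  then have lm: "?C p \<in> lmeasurable" for p
    using assms(2) open_cell by (intro lmeasurable_open bounded_Int) auto
  then have lU: "U \<in> lmeasurable" unfolding U_def by (intro fmeasurable.finite_UN) auto
  have sub: "S \<subseteq> U \<union> G"
  proof
    fix p assume p: "p \<in> S"
    then have b: "0 \<le> fst p" "fst p \<le> real L * c" "0 \<le> snd p" "snd p \<le> real L * c"
      using subsetD[OF assms(3) p] by (simp_all add: mem_Times_iff)
    consider a b where "a < L" "b < L" "fst p \<in> strip c a" "snd p \<in> strip c b" | "p \<in> G"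
      using in_strip_or_grid[OF \<open>0 < c\<close> b(1,2)] in_strip_or_grid[OF \<open>0 < c\<close> b(3,4)]
      unfolding G_def by blast
    then show "p \<in> U \<union> G"
    proof cases
      case (1 a b)
      then have "p \<in> ?C (a, b)" using p by (simp add: cell_def mem_Times_iff)
      then show ?thesis using 1 unfolding U_def by blast
    qed simp
  qed
  have "negligible G" unfolding G_def by (rule negligible_grid)
  then have G: "G \<in> lmeasurable" "measure lebesgue G = 0"
    by (simp_all add: negligible_iff_measure)
  have "measure lebesgue S \<le> measure lebesgue (U \<union> G)"
    using sub fmeasurable.Un[OF lU G(1)] \<open>open S\<close> by (intro measure_mono_fmeasurable) auto
  also have "\<dots> \<le> measure lebesgue U + measure lebesgue G"
    using lU G(1) by (intro measure_Un_le fmeasurableD)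
  also have "\<dots> = measure lebesgue U" using G(2) by simp
  also have "\<dots> \<le> (\<Sum>p\<in>{..<L} \<times> {..<L}. measure lebesgue (?C p))"
    unfolding U_def by (rule measure_UNION_le) (simp_all add: fmeasurableD[OF lm])
  also have "\<dots> = (\<Sum>a<L. \<Sum>b<L. measure lebesgue (S \<inter> cell c a b))"
    by (simp add: sum.cartesian_product case_prod_unfold)
  finally show ?thesis .
qed

text \<open>Every index below \<open>K * M\<close> is \<open>i + K * m\<close> for unique
  \<open>i < K\<close> and \<open>m < M\<close>: sum by blocks of length \<open>K\<close>, then
  exchange the sums.\<close>

lemma sum_residues:
  fixes f :: "nat \<Rightarrow> real"
  shows "(\<Sum>a<K * M. f a) = (\<Sum>i<K. \<Sum>m<M. f (i + K * m))"
proof -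
  have "(\<Sum>m<M. \<Sum>i<K. f (i + K * m)) = (\<Sum>m<M. sum f {m * K..<m * K + K})"
  proof (rule sum.cong[OF refl])
    fix m
    have "sum f {0 + m * K..<K + m * K} = (\<Sum>i<K. f (i + m * K))"
      by (simp only: sum.shift_bounds_nat_ivl atLeast0LessThan)
    then show "(\<Sum>i<K. f (i + K * m)) = sum f {m * K..<m * K + K}"
      by (simp add: algebra_simps)
  qed
  also have "\<dots> = (\<Sum>a<K * M. f a)" by (simp add: sum.nat_group mult.commute)
  finally show ?thesis by (subst sum.swap) simp
qed

section \<open>Transfer of containment to the dilation\<close>

text \<open>The witnesses for the dilation undo the factor \<open>q\<close>, apply the given
  embedding of \<open>P\<close> into the compression, and pull the strips apart by
  \<open>spread\<close>. It is used contrapositively: compressions of a set free of the dilation are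
  \<open>P\<close>-free.\<close>

lemma contains_dilation_of_compression:
  assumes "0 < c" "0 < q" "finite P" and kc: "q * d \<le> real k * c"
    and rows: "\<And>R R'. consecutive_rows P R R' \<Longrightarrow> row_dist R R' \<in> {c..d}"
    and cols: "\<And>C C'. consecutive_columns P C C' \<Longrightarrow> column_dist C C' \<in> {c..d}"
    and "contains (compression c k M S i j) P"
  shows "contains S (dilation q P)"
proof -
  obtain fX fY where
    X0: "\<forall>x0\<in>fst ` P. \<forall>x1\<in>fst ` P. x0 > x1 \<longrightarrow> 1 \<le> (fX x0 - fX x1) / (x0 - x1)" and
    Y0: "\<forall>y0\<in>snd ` P. \<forall>y1\<in>snd ` P. y0 > y1 \<longrightarrow> 1 \<le> (fY y0 - fY y1) / (y0 - y1)" and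
    S0: "\<forall>(x, y)\<in>P. (fX x, fY y) \<in> compression c k M S i j"
    using assms(7) unfolding contains_def by (elim bexE conjE)
  have fX: "y - x \<le> fX y - fX x" if "x \<in> fst ` P" "y \<in> fst ` P" "x < y" for x y
    using bspec[OF bspec[OF X0 that(2)] that(1)] that(3) by (simp add: pos_le_divide_eq)
  have fY: "y - x \<le> fY y - fY x" if "x \<in> snd ` P" "y \<in> snd ` P" "x < y" for x y
    using bspec[OF bspec[OF Y0 that(2)] that(1)] that(3) by (simp add: pos_le_divide_eq)
  have fS: "(fX x, fY y) \<in> compression c k M S i j" if "(x, y) \<in> P" for x y
    using S0 that by blast
  define gX where "gX z = spread c k i (fX (z / q))" for z
  define gY where "gY z = spread c k j (fY (z / q))" for z
  have S: "(gX (q * x), gY (q * y)) \<in> S" if "(x, y) \<in> P" for x y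
    using spread_compression[OF \<open>0 < c\<close> fS[OF that]] \<open>0 < q\<close> by (simp add: gX_def gY_def)
  have dil: "dilation q P = (\<lambda>p. (q * fst p, q * snd p)) ` P"
    unfolding dilation_def using \<open>0 < q\<close> by (auto simp: image_iff Bex_def)
  \<comment> \<open>Both coordinate sets are multiples by \<open>q\<close> of those of
    \<open>P\<close>, so every condition can be checked at \<open>q * x\<close> with
    \<open>x\<close> a coordinate of \<open>P\<close>.\<close>
  have im: "fst ` dilation q P = (*) q ` fst ` P" "snd ` dilation q P = (*) q ` snd ` P"
    by (simp_all add: dil image_image)
  have X: "1 \<le> (gX (q * x) - gX (q * y)) / (q * x - q * y)"
    if xy: "x \<in> fst ` P" "y \<in> fst ` P" "q * x > q * y" for x y
  proof -
    have "q * (x - y) \<le> spread c k i (fX x) - spread c k i (fX y)"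
    proof (rule spread_expands[OF \<open>0 < c\<close> _ kc \<open>0 < q\<close> consecutive_coords_dist[OF cols] fX xy(2,1)])
      show "y < x" using xy(3) \<open>0 < q\<close> by simp
    qed (use \<open>finite P\<close> in simp_all)
    then show ?thesis
      using xy(3) \<open>0 < q\<close> by (simp add: gX_def pos_le_divide_eq right_diff_distrib)
  qed
  have Y: "1 \<le> (gY (q * x) - gY (q * y)) / (q * x - q * y)"
    if xy: "x \<in> snd ` P" "y \<in> snd ` P" "q * x > q * y" for x y
  proof -
    have "q * (x - y) \<le> spread c k j (fY x) - spread c k j (fY y)"
    proof (rule spread_expands[OF \<open>0 < c\<close> _ kc \<open>0 < q\<close> consecutive_coords_dist[OF rows] fY xy(2,1)])
      show "y < x" using xy(3) \<open>0 < q\<close> by simp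
    qed (use \<open>finite P\<close> in simp_all)
    then show ?thesis
      using xy(3) \<open>0 < q\<close> by (simp add: gY_def pos_le_divide_eq right_diff_distrib)
  qed
  have gX: "gX \<in> fst ` dilation q P \<rightarrow> fst ` S" and gY: "gY \<in> snd ` dilation q P \<rightarrow> snd ` S"
    unfolding im using S by (auto intro!: rev_image_eqI)
  show ?thesis
    unfolding contains_def
  proof (rule bexI[OF _ gX], rule bexI[OF _ gY], intro conjI)
    show "\<forall>(x, y)\<in>dilation q P. (gX x, gY y) \<in> S"
      using S by (auto simp: dilation_def)
  qed (use X Y in \<open>unfold im, blast+\<close>)
qed

section \<open>Bounds for \<open>opx\<close> and the final count\<close>

text \<open>A real \<open>Sup\<close> is an upper bound only for a set that is bounded above; the
  measure of the square supplies that bound.\<close>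

lemma measure_le_opx:
  assumes "open S" "S \<subseteq> {0..n} \<times> {0..n}" "free_of S P"
  shows "measure lebesgue S \<le> opx n P"
  unfolding opx_def
proof (rule cSup_upper)
  have l: "{0..n} \<times> {0..n} \<in> lmeasurable"
    by (intro lmeasurable_compact compact_Times compact_Icc)
  have "measure lebesgue T \<le> measure lebesgue ({0..n} \<times> {0..n})"
    if "open T" "T \<subseteq> {0..n} \<times> {0..n}" for T
    using that l by (intro measure_mono_fmeasurable) auto
  then show "bdd_above {measure lebesgue S |S. open S \<and> S \<subseteq> {0..n} \<times> {0..n} \<and> free_of S P}"
    by (intro bdd_aboveI[of _ "measure lebesgue ({0..n} \<times> {0..n})"]) blast
qed (use assms in blast)

lemma opx_le:
  assumes "P \<noteq> {}"
    and "\<And>S. \<lbrakk>open S; S \<subseteq> {0..n} \<times> {0..n}; free_of S P\<rbrakk> \<Longrightarrow> measure lebesgue S \<le> B"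
  shows "opx n P \<le> B"
  unfolding opx_def
proof (rule cSup_least)
  \<comment> \<open>A least upper bound argument for \<open>Sup\<close> requires a nonempty set of
    measures; the empty set is a free set because \<open>P\<close> has a point to be mapped.\<close>
  have "free_of {} P" using assms(1) by (auto simp: contains_def)
  then show "{measure lebesgue S |S. open S \<and> S \<subseteq> {0..n} \<times> {0..n} \<and> free_of S P} \<noteq> {}"
    by blast
qed (use assms(2) in blast)

theorem lemma2p12:
  fixes c d q n :: real and P :: "(real \<times> real) set"
  assumes "0 < c" and "c \<le> d"
    and "finite P" and "P \<noteq> {}"
    and "\<And>R R'. consecutive_rows P R R' \<Longrightarrow> row_dist R R' \<in> {c..d}"
    and "\<And>C C'. consecutive_columns P C C' \<Longrightarrow> column_dist C C' \<in> {c..d}"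
    and "q > 1" and "n > 0"
  shows "opx n (dilation q P)
    \<le> (real_of_int \<lceil>q * d / c\<rceil> + 1)\<^sup>2
      * opx (real_of_int \<lceil>real_of_int \<lceil>n / c\<rceil> / (real_of_int \<lceil>q * d / c\<rceil> + 1)\<rceil> * c) P"
proof -
  define k where "k = nat \<lceil>q * d / c\<rceil>"
  define N where "N = \<lceil>n / c\<rceil>"
  \<comment> \<open>\<open>M\<close> is the least number of cells per side for which
    \<open>k + 1\<close> residue classes of \<open>M\<close> indices each exhaust the
    \<open>N\<close> strips meeting the square.\<close>
  define M where "M = nat \<lceil>real_of_int N / (real k + 1)\<rceil>"
  let ?K = "k + 1"
  have "0 < q * d / c" using assms by simp
  \<comment> \<open>Positivity ensures that \<open>nat\<close> does not truncate the
    ceiling.\<close>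
  then have k: "real_of_int \<lceil>q * d / c\<rceil> = real k"
    unfolding k_def by simp
  have "q * d / c \<le> real k" using k by (metis le_of_int_ceiling)
  then have kc: "q * d \<le> real k * c" using \<open>0 < c\<close> by (simp add: field_simps)
  have "0 < n / c" using assms by simp
  then have N: "0 \<le> real_of_int N" "n / c \<le> real_of_int N" unfolding N_def by linarith+
  then have "0 \<le> real_of_int N / (real k + 1)" by simp
  then have M: "real_of_int \<lceil>real_of_int N / (real k + 1)\<rceil> = real M"
    unfolding M_def by (simp add: zero_le_ceiling less_le_trans)
  then have "real_of_int N / (real k + 1) \<le> real M" by (metis le_of_int_ceiling)
  then have "real_of_int N \<le> real (?K * M)" by (simp add: field_simps)
  then have nL: "n \<le> real (?K * M) * c"
    using N \<open>0 < c\<close> by (simp only: pos_divide_le_eq[symmetric])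
  have "opx n (dilation q P) \<le> (real k + 1)\<^sup>2 * opx (real M * c) P"
  proof (rule opx_le)
    show "dilation q P \<noteq> {}" using \<open>P \<noteq> {}\<close> by (auto simp: dilation_def)
  next
    fix S assume S: "open S" "S \<subseteq> {0..n} \<times> {0..n}" "free_of S (dilation q P)"
    let ?\<mu> = "\<lambda>a b. measure lebesgue (S \<inter> cell c a b)"
    have "bounded S"
      by (rule bounded_subset[OF _ S(2)]) (intro bounded_Times bounded_closed_interval)
    have free: "free_of (compression c k M S i j) P" for i j
      using contains_dilation_of_compression[OF _ _ _ kc assms(5,6)] assms(1,3,7) S(3) by auto
    have "S \<subseteq> {0..real (?K * M) * c} \<times> {0..real (?K * M) * c}"
      using S(2) nL by fastforce
    then have "measure lebesgue S \<le> (\<Sum>a<?K * M. \<Sum>b<?K * M. ?\<mu> a b)"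
      using measure_le_sum_cells \<open>0 < c\<close> S(1) by blast
    also have "\<dots> = (\<Sum>i<?K. \<Sum>a<M. \<Sum>j<?K. \<Sum>b<M. ?\<mu> (i + ?K * a) (j + ?K * b))"
      unfolding sum_residues ..
    \<comment> \<open>With both residues outermost, the inner double sum is the measure of a single
      compression.\<close>
    also have "\<dots> = (\<Sum>i<?K. \<Sum>j<?K. \<Sum>a<M. \<Sum>b<M. ?\<mu> (i + ?K * a) (j + ?K * b))"
      by (intro sum.cong[OF refl] sum.swap)
    also have "\<dots> = (\<Sum>i<?K. \<Sum>j<?K. measure lebesgue (compression c k M S i j))"
      by (simp only: measure_compression[OF \<open>0 < c\<close> S(1) \<open>bounded S\<close>])
    also have "\<dots> \<le> (\<Sum>i<?K. \<Sum>j<?K. opx (real M * c) P)"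
      by (intro sum_mono measure_le_opx open_compression S(1) compression_subset free \<open>0 < c\<close>)
    also have "\<dots> = (real k + 1)\<^sup>2 * opx (real M * c) P"
      by (simp add: power2_eq_square algebra_simps)
    finally show "measure lebesgue S \<le> (real k + 1)\<^sup>2 * opx (real M * c) P" .
  qed
  then show ?thesis unfolding k N_def[symmetric] M .
qed

end
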